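(* Let $X$ be a uniform space whose uniformity is generated by a saturated family of pseudometrics $\{d_\lambda\}_{\lambda\in\Lambda}$, let $D$ be a subset of $X$ and let $T:D\to\mathcal{C}(X)$ be a multi-function. (1) If $T$ is lower semi-continuous, then $T$ is weakly lower semi-continuous. (2) If $T$ is upper semi-continuous, then $T$ is weakly upper semi-continuous.
   Context: The family $\{d_\lambda\}_{\lambda\in\Lambda}$ is saturated if for all $\lambda,\mu\in\Lambda$ there is $\nu\in\Lambda$ with $\max\{d_\lambda(x,y),d_\mu(x,y)\}\le d_\nu(x,y)$ for all $x,y\in X$. $\mathcal{C}(X)$ is the family of closed nonempty subsets of $X$, and $d_\lambda(a,A)=\inf_{x\in A}d_\lambda(a,x)$. For $B\subseteq X$, $T^{-1}(B)=\{x\in D:Tx\cap B\neq\emptyset\}$. $T$ is lower semi-continuous if $T^{-1}(G)$ is open in $D$ for every open $G\subseteq X$; upper semi-continuous if $T^{-1}(F)$ is closed in $D$ for every closed $F\subseteq X$. $T$ is weakly lower (respectively, weakly upper) semi-continuous if for every $\lambda\in\Lambda$ and $\alpha\ge 0$ the set $\{x\in D:d_\lambda(x,Tx)<\alpha\}$ (respectively, $\{x\in D:d_\lambda(x,Tx)>\alpha\}$) is open in $D$. *)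

theory Defs
  imports "HOL-Analysis.Analysis"
begin

definition pseudometric :: "('a \<Rightarrow> 'a \<Rightarrow> real) \<Rightarrow> bool" where
  "pseudometric d \<longleftrightarrow>
     (\<forall>x y. 0 \<le> d x y) \<and> (\<forall>x. d x x = 0) \<and> (\<forall>x y. d x y = d y x) \<and>
     (\<forall>x y z. d x z \<le> d x y + d y z)"

definition saturated :: "'i set \<Rightarrow> ('i \<Rightarrow> 'a \<Rightarrow> 'a \<Rightarrow> real) \<Rightarrow> bool" where
  "saturated \<Lambda> d \<longleftrightarrow>
     (\<forall>l\<in>\<Lambda>. \<forall>m\<in>\<Lambda>. \<exists>n\<in>\<Lambda>. \<forall>x y. max (d l x y) (d m x y) \<le> d n x y)"

(* The uniformity of the type class is the coarsest filter containing all the entourages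
   {(x, y). d l x y < e} with l in the index set and e > 0. *)
definition generates_uniformity ::
  "'i set \<Rightarrow> ('i \<Rightarrow> 'a::uniform_space \<Rightarrow> 'a \<Rightarrow> real) \<Rightarrow> bool" where
  "generates_uniformity \<Lambda> d \<longleftrightarrow>
     (uniformity :: ('a \<times> 'a) filter) =
       (INF l\<in>\<Lambda>. INF e\<in>{0<..}. principal {(x, y). d l x y < e})"

definition closed_nonempty_sets :: "'a::topological_space set set" where
  "closed_nonempty_sets = {A. closed A \<and> A \<noteq> {}}"

(* Used only for nonempty A and a nonnegative d, where the real infimum is the genuine one. *)
definition dist_to_set :: "('a \<Rightarrow> 'a \<Rightarrow> real) \<Rightarrow> 'a \<Rightarrow> 'a set \<Rightarrow> real" where
  "dist_to_set d a A = (INF x\<in>A. d a x)"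

(* A multi-function on D is a total set-valued function of which only the values on D matter. *)
definition multi_vimage :: "'a set \<Rightarrow> ('a \<Rightarrow> 'b set) \<Rightarrow> 'b set \<Rightarrow> 'a set" where
  "multi_vimage D T B = {x \<in> D. T x \<inter> B \<noteq> {}}"

definition lower_semicontinuous ::
  "'a::topological_space set \<Rightarrow> ('a \<Rightarrow> 'b::topological_space set) \<Rightarrow> bool" where
  "lower_semicontinuous D T \<longleftrightarrow>
     (\<forall>G. open G \<longrightarrow> openin (top_of_set D) (multi_vimage D T G))"

definition upper_semicontinuous ::
  "'a::topological_space set \<Rightarrow> ('a \<Rightarrow> 'b::topological_space set) \<Rightarrow> bool" where
  "upper_semicontinuous D T \<longleftrightarrow>
     (\<forall>F. closed F \<longrightarrow> closedin (top_of_set D) (multi_vimage D T F))"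

definition weakly_lower_semicontinuous ::
  "'i set \<Rightarrow> ('i \<Rightarrow> 'a::topological_space \<Rightarrow> 'a \<Rightarrow> real) \<Rightarrow> 'a set \<Rightarrow> ('a \<Rightarrow> 'a set) \<Rightarrow> bool" where
  "weakly_lower_semicontinuous \<Lambda> d D T \<longleftrightarrow>
     (\<forall>l\<in>\<Lambda>. \<forall>\<alpha>\<ge>0. openin (top_of_set D) {x \<in> D. dist_to_set (d l) x (T x) < \<alpha>})"

definition weakly_upper_semicontinuous ::
  "'i set \<Rightarrow> ('i \<Rightarrow> 'a::topological_space \<Rightarrow> 'a \<Rightarrow> real) \<Rightarrow> 'a set \<Rightarrow> ('a \<Rightarrow> 'a set) \<Rightarrow> bool" where
  "weakly_upper_semicontinuous \<Lambda> d D T \<longleftrightarrow>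
     (\<forall>l\<in>\<Lambda>. \<forall>\<alpha>\<ge>0. openin (top_of_set D) {x \<in> D. dist_to_set (d l) x (T x) > \<alpha>})"

end

theory Submission
  imports Defs
begin

text \<open>Both parts test openness in \<open>D\<close> point by point: around a point x of the set
  there is a relatively open U inside the set, cut out by a semi-continuity condition and a
  \<open>d l\<close>-ball about x. If d(x,Tx) < \<alpha>, some y in Tx has d(x,y) < \<alpha>; lower
  semi-continuity lets nearby values T x' meet a small ball about y, so d(x',Tx') stays below
  \<alpha>. If d(x,Tx) > \<alpha>, then Tx misses a closed ball about x of radius slightly above
  \<alpha>; upper semi-continuity lets nearby values miss it too, so d(x',Tx') stays above \<alpha>.
  The topological input is \<open>open_pseudometric_ball\<close> and
  \<open>closed_pseudometric_cball\<close>; \<open>dist_to_set_less_iff\<close> passes between the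
  infimum and points of the set.\<close>

lemma pseudometricD:
  assumes "pseudometric d"
  shows "0 \<le> d x y" "d x x = 0" "d x y = d y x" "d x z \<le> d x y + d y z"
  using assms unfolding pseudometric_def by blast+

text \<open>The uniformity is an infimum of principal filters, so it lies below each of them. This
  turns the generation hypothesis into usable entourages.\<close>

lemma eventually_uniformity_pseudometric_less:
  assumes "generates_uniformity \<Lambda> d" and "l \<in> \<Lambda>" and "0 < e"
  shows "\<forall>\<^sub>F (x, y) in uniformity. d l x y < e"
proof -
  have "uniformity \<le> principal {(x, y). d l x y < e}"
    unfolding assms(1)[unfolded generates_uniformity_def]
    using assms(2,3) by (intro INF_lower2[of l] INF_lower2[of e]) auto
  then show ?thesis
    by (simp add: le_principal case_prod_unfold)
qed

text \<open>By the triangle inequality, a point y of the ball can be moved by less than the slack r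
  - d(x,y) without leaving it.\<close>

lemma open_pseudometric_ball:
  assumes "generates_uniformity \<Lambda> d" and "l \<in> \<Lambda>" and pm: "pseudometric (d l)"
  shows "open {y. d l x y < r}"
  unfolding open_uniformity
proof clarify
  fix y assume "d l x y < r"
  then have "\<forall>\<^sub>F (y', z) in uniformity. d l y' z < r - d l x y"
    using assms by (intro eventually_uniformity_pseudometric_less) auto
  then show "\<forall>\<^sub>F (y', z) in uniformity. y' = y \<longrightarrow> z \<in> {y. d l x y < r}"
  proof (rule eventually_mono, clarify)
    fix z assume "d l y z < r - d l x y"
    then show "d l x z < r" using pseudometricD(4)[OF pm, of x z y] by linarith
  qed
qed

text \<open>The complement is open: a point y outside exceeds the radius by d(x,y) - r, and moving
  it by less than that keeps it outside.\<close>

lemma closed_pseudometric_cball: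
  assumes "generates_uniformity \<Lambda> d" and "l \<in> \<Lambda>" and pm: "pseudometric (d l)"
  shows "closed {y. d l x y \<le> r}"
  unfolding closed_def open_uniformity
proof (rule ballI)
  fix y assume "y \<in> - {y. d l x y \<le> r}"
  then have "\<forall>\<^sub>F (y', z) in uniformity. d l y' z < d l x y - r"
    using assms by (intro eventually_uniformity_pseudometric_less) auto
  then show "\<forall>\<^sub>F (y', z) in uniformity. y' = y \<longrightarrow> z \<in> - {y. d l x y \<le> r}"
  proof (rule eventually_mono, clarify)
    fix z assume "d l y z < d l x y - r" and "d l x z \<le> r"
    then show False
      using pseudometricD(4)[OF pm, of x y z] pseudometricD(3)[OF pm, of y z] by linarith
  qed
qed

text \<open>The real infimum is genuine here: the set is nonempty and the values are bounded below
  by 0. Read negatively, a bound from below on all of A bounds the infimum.\<close>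

lemma dist_to_set_less_iff:
  assumes "pseudometric d" and "A \<noteq> {}"
  shows "dist_to_set d a A < r \<longleftrightarrow> (\<exists>x\<in>A. d a x < r)"
  unfolding dist_to_set_def
  using assms by (intro cINF_less_iff bdd_belowI2[where m = 0] pseudometricD(1))

lemma lower_semicontinuous_imp_weakly:
  assumes pm: "\<And>l. l \<in> \<Lambda> \<Longrightarrow> pseudometric (d l)"
    and gen: "generates_uniformity \<Lambda> d"
    and ne: "\<And>x. x \<in> D \<Longrightarrow> T x \<noteq> {}"
    and lsc: "lower_semicontinuous D T"
  shows "weakly_lower_semicontinuous \<Lambda> d D T"
  unfolding weakly_lower_semicontinuous_def
proof (intro ballI allI impI)
  fix l and \<alpha> :: real assume l: "l \<in> \<Lambda>"
  note less_iff = dist_to_set_less_iff[OF pm[OF l] ne]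
  show "openin (top_of_set D) {x \<in> D. dist_to_set (d l) x (T x) < \<alpha>}"
    unfolding openin_subopen[of _ "{x \<in> D. dist_to_set (d l) x (T x) < \<alpha>}"]
  proof clarify
    fix x assume x: "x \<in> D" and "dist_to_set (d l) x (T x) < \<alpha>"
    then obtain y where y: "y \<in> T x" "d l x y < \<alpha>"
      using less_iff by blast
    \<comment> \<open>Half of the slack: going from x' to a point z of T x' through x and y costs
      one e from x' to x and one e from y to z.\<close>
    define e where "e = (\<alpha> - d l x y) / 2"
    have e: "0 < e" "\<alpha> = d l x y + 2 * e"
      using y by (auto simp: e_def field_simps)
    let ?U = "multi_vimage D T {z. d l y z < e} \<inter> {x'. d l x x' < e}"
    have "openin (top_of_set D) ?U"
      using lsc open_pseudometric_ball[OF gen l pm[OF l]]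
      unfolding lower_semicontinuous_def by (blast intro: openin_Int_open)
    moreover have "x \<in> ?U"
      using x y e pseudometricD(2)[OF pm[OF l]] by (auto simp: multi_vimage_def)
    moreover have "?U \<subseteq> {x \<in> D. dist_to_set (d l) x (T x) < \<alpha>}"
    proof
      fix x' assume "x' \<in> ?U"
      then obtain z where z: "x' \<in> D" "z \<in> T x'" "d l y z < e" "d l x x' < e"
        by (auto simp: multi_vimage_def)
      have "d l x' z \<le> d l x x' + d l x y + d l y z"
        using pseudometricD(4)[OF pm[OF l], of x' z x] pseudometricD(4)[OF pm[OF l], of x z y]
          pseudometricD(3)[OF pm[OF l], of x x'] by linarith
      then have "d l x' z < \<alpha>" using z e by linarith
      then show "x' \<in> {x \<in> D. dist_to_set (d l) x (T x) < \<alpha>}"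
        using z less_iff by blast
    qed
    ultimately show "\<exists>U. openin (top_of_set D) U \<and> x \<in> U \<and>
        U \<subseteq> {x \<in> D. dist_to_set (d l) x (T x) < \<alpha>}" by blast
  qed
qed

lemma upper_semicontinuous_imp_weakly:
  assumes pm: "\<And>l. l \<in> \<Lambda> \<Longrightarrow> pseudometric (d l)"
    and gen: "generates_uniformity \<Lambda> d"
    and ne: "\<And>x. x \<in> D \<Longrightarrow> T x \<noteq> {}"
    and usc: "upper_semicontinuous D T"
  shows "weakly_upper_semicontinuous \<Lambda> d D T"
  unfolding weakly_upper_semicontinuous_def
proof (intro ballI allI impI)
  fix l and \<alpha> :: real assume l: "l \<in> \<Lambda>"
  note less_iff = dist_to_set_less_iff[OF pm[OF l] ne]
  show "openin (top_of_set D) {x \<in> D. dist_to_set (d l) x (T x) > \<alpha>}"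
    unfolding openin_subopen[of _ "{x \<in> D. dist_to_set (d l) x (T x) > \<alpha>}"]
  proof clarify
    fix x assume x: "x \<in> D" and gt: "dist_to_set (d l) x (T x) > \<alpha>"
    \<comment> \<open>The gap is spent in thirds: one puts Tx outside the closed ball
      \<open>?F\<close> of radius \<alpha> + 2e, one pays for moving x to x', and one remains as a
      margin above \<alpha>.\<close>
    define e where "e = (dist_to_set (d l) x (T x) - \<alpha>) / 3"
    have e: "0 < e" "dist_to_set (d l) x (T x) = \<alpha> + 3 * e"
      using gt by (auto simp: e_def field_simps)
    let ?F = "{z. d l x z \<le> \<alpha> + 2 * e}"
    let ?U = "(D - multi_vimage D T ?F) \<inter> {x'. d l x x' < e}"
    have "closedin (top_of_set D) (multi_vimage D T ?F)"
      using usc closed_pseudometric_cball[OF gen l pm[OF l]]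
      unfolding upper_semicontinuous_def by blast
    then have "openin (top_of_set D) (D - multi_vimage D T ?F)"
      by (simp add: closedin_def)
    then have "openin (top_of_set D) ?U"
      using open_pseudometric_ball[OF gen l pm[OF l]] by (rule openin_Int_open)
    moreover have "x \<in> ?U"
    proof -
      \<comment> \<open>Otherwise z would witness an infimum below d(x,z) + e, hence below \<alpha>
        + 3e, which is its value.\<close>
      have "\<not> d l x z \<le> \<alpha> + 2 * e" if "z \<in> T x" for z
        using less_iff[OF x, of x "d l x z + e"] that e by force
      then show ?thesis
        using x e pseudometricD(2)[OF pm[OF l]] by (auto simp: multi_vimage_def)
    qed
    moreover have "?U \<subseteq> {x \<in> D. dist_to_set (d l) x (T x) > \<alpha>}"
    proof
      fix x' assume x': "x' \<in> ?U"
      have "\<not> d l x' z < \<alpha> + e" if "z \<in> T x'" for z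
      proof -
        have "d l x z > \<alpha> + 2 * e" "d l x x' < e"
          using x' that by (auto simp: multi_vimage_def)
        then show ?thesis
          using pseudometricD(4)[OF pm[OF l], of x z x'] by linarith
      qed
      \<comment> \<open>The infimum need not be attained, so pointwise bounds yield only a weak
        inequality; the margin e makes it strict against \<alpha>.\<close>
      then have "\<not> dist_to_set (d l) x' (T x') < \<alpha> + e"
        using x' less_iff by blast
      then show "x' \<in> {x \<in> D. dist_to_set (d l) x (T x) > \<alpha>}"
        using x' e by auto
    qed
    ultimately show "\<exists>U. openin (top_of_set D) U \<and> x \<in> U \<and>
        U \<subseteq> {x \<in> D. dist_to_set (d l) x (T x) > \<alpha>}" by blast
  qed
qed

theorem theorem3:
  fixes \<Lambda> :: "'i set"
    and d :: "'i \<Rightarrow> 'a::uniform_space \<Rightarrow> 'a \<Rightarrow> real"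
    and D :: "'a set"
    and T :: "'a \<Rightarrow> 'a set"
  assumes "\<And>l. l \<in> \<Lambda> \<Longrightarrow> pseudometric (d l)"
    and "saturated \<Lambda> d"
    and "generates_uniformity \<Lambda> d"
    and "\<And>x. x \<in> D \<Longrightarrow> T x \<in> closed_nonempty_sets"
  shows "(lower_semicontinuous D T \<longrightarrow> weakly_lower_semicontinuous \<Lambda> d D T) \<and>
         (upper_semicontinuous D T \<longrightarrow> weakly_upper_semicontinuous \<Lambda> d D T)"
proof -
  have "T x \<noteq> {}" if "x \<in> D" for x
    using assms(4)[OF that] by (simp add: closed_nonempty_sets_def)
  then show ?thesis
    using lower_semicontinuous_imp_weakly[of \<Lambda> d D T]
      upper_semicontinuous_imp_weakly[of \<Lambda> d D T] assms(1,3)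
    by blast
qed

end
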